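(* Let $\mathcal S$ be the bilateral forward shift on $H$, $\mathcal S(e_j)=e_{j+1}$ for all $j\in\mathbb Z$, let $U=2\mathcal S$, and let $L_U:B_0(H)\to B_0(H)$, $L_U(F)=UF$. Then $L_U$ is a non-supercyclic, topologically C*-transitive and generalized numerically transitive operator on $B_0(H)$. Moreover, $L_U$ is not WOT-hypercyclic.
   Context: $H$ is a complex separable Hilbert space with an orthonormal basis $\{e_j\}_{j\in\mathbb Z}$, and $B_0(H)$ is the C*-algebra of compact operators on $H$ with the operator norm, with unit sphere $S(B_0(H))$. Let $T\in\mathcal B(B_0(H))$. $T$ is supercyclic if there is $F\in B_0(H)$ such that $\{\lambda T^nF:n\ge0,\lambda\in\mathbb C\}$ is dense in $B_0(H)$. $T$ is WOT-hypercyclic if there is $F\in B_0(H)$ whose orbit $\{T^nF:n\ge0\}$ is dense in $B_0(H)$ in the weak operator topology. $T$ is topologically C*-transitive on $B_0(H)$ (with respect to $\varphi(A,B)=B^*A$) if for every nonempty open $W\subseteq S(B_0(H))\times S(B_0(H))$ and nonempty open $O\subseteq B_0(H)$ there exist $n\in\mathbb N$ and $(A,B)\in W$ with $B^*T^n(A)\in O$. $T$ is generalized numerically transitive on $B_0(H)$ if for every nonempty open $\widetilde O\subseteq B_0(H)\times B_0(H)$ and nonempty open $O\subseteq B_0(H)$ there exist $n\in\mathbb N$ and $(A,B)\in\widetilde O$ with $A\,T^n(B)\in O$. *)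

theory Defs
  imports "HOL-Analysis.Analysis"
begin

section \<open>Complex Hilbert spaces\<close>

text \<open>The inner product is linear in the first argument and conjugate-linear in the second. The real
  scalar multiplication and the norm of the underlying Banach space are those induced by the complex
  structure; the last axiom also yields positivity and definiteness.\<close>

class complex_hilbert_space = banach +
  fixes scaleC :: "complex \<Rightarrow> 'a \<Rightarrow> 'a" (infixr \<open>*\<^sub>C\<close> 75)
    and cinner :: "'a \<Rightarrow> 'a \<Rightarrow> complex"
  assumes scaleC_add_right: "c *\<^sub>C (x + y) = c *\<^sub>C x + c *\<^sub>C y"
    and scaleC_add_left: "(c + d) *\<^sub>C x = c *\<^sub>C x + d *\<^sub>C x"
    and scaleC_scaleC: "c *\<^sub>C (d *\<^sub>C x) = (c * d) *\<^sub>C x"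
    and scaleR_scaleC: "r *\<^sub>R x = complex_of_real r *\<^sub>C x"
    and cinner_commute: "cinner x y = cnj (cinner y x)"
    and cinner_add_left: "cinner (x + y) z = cinner x z + cinner y z"
    and cinner_scaleC_left: "cinner (c *\<^sub>C x) y = c * cinner x y"
    and cinner_self: "cinner x x = complex_of_real ((norm x)\<^sup>2)"

lemma scaleC_vector_space: "vector_space (scaleC :: complex \<Rightarrow> 'h::complex_hilbert_space \<Rightarrow> 'h)"
proof
  show "1 *\<^sub>C x = x" for x :: 'h
    using scaleR_scaleC[of 1 x] by simp
qed (simp_all add: scaleC_add_right scaleC_add_left scaleC_scaleC)

lemma norm_scaleC: "norm (c *\<^sub>C x) = cmod c * norm (x :: 'h::complex_hilbert_space)"
proof -
  have "cinner (c *\<^sub>C x) (c *\<^sub>C x) = c * cnj c * cinner x x"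
    using cinner_commute[of x "c *\<^sub>C x"] cinner_commute[of x x]
    by (simp add: cinner_scaleC_left)
  then have "complex_of_real ((norm (c *\<^sub>C x))\<^sup>2) = complex_of_real ((cmod c * norm x)\<^sup>2)"
    by (simp add: cinner_self complex_norm_square[symmetric] power_mult_distrib flip: of_real_power)
  then have "(norm (c *\<^sub>C x))\<^sup>2 = (cmod c * norm x)\<^sup>2"
    using of_real_eq_iff by blast
  then show ?thesis
    by (simp add: power2_eq_iff_nonneg)
qed

lemma bounded_linear_scaleC: "bounded_linear (\<lambda>x :: 'h::complex_hilbert_space. c *\<^sub>C x)"
  by (rule bounded_linear_intro[where K = "cmod c"])
    (simp_all add: scaleC_add_right scaleR_scaleC scaleC_scaleC norm_scaleC mult.commute)

definition orthonormal_basis :: "('i \<Rightarrow> 'h::complex_hilbert_space) \<Rightarrow> bool" where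
  "orthonormal_basis e \<longleftrightarrow>
     (\<forall>i j. cinner (e i) (e j) = (if i = j then 1 else 0)) \<and>
     closure (module.span scaleC (range e)) = UNIV"


section \<open>Bounded and compact operators\<close>

text \<open>The type \<open>'h \<Rightarrow>\<^sub>L 'h\<close> consists of the bounded \<^emph>\<open>real\<close>-linear maps, with the operator norm.
  The bounded operators on the complex space are its complex-linear members.\<close>

abbreviation clinear_op :: "('h::complex_hilbert_space \<Rightarrow>\<^sub>L 'h) \<Rightarrow> bool" where
  "clinear_op F \<equiv> Vector_Spaces.linear scaleC scaleC (blinfun_apply F)"

lift_definition scaleC_op ::
  "complex \<Rightarrow> ('h::complex_hilbert_space \<Rightarrow>\<^sub>L 'h) \<Rightarrow> ('h \<Rightarrow>\<^sub>L 'h)"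
  is "\<lambda>c F x. c *\<^sub>C F x"
  by (rule bounded_linear_compose[OF bounded_linear_scaleC])

definition adjoint_op :: "('h::complex_hilbert_space \<Rightarrow>\<^sub>L 'h) \<Rightarrow> ('h \<Rightarrow>\<^sub>L 'h)" where
  "adjoint_op F = (THE G :: 'h \<Rightarrow>\<^sub>L 'h. \<forall>x y. cinner (F x) y = cinner x (G y))"

definition compact_ops :: "('h::complex_hilbert_space \<Rightarrow>\<^sub>L 'h) set" where
  "compact_ops = {F. clinear_op F \<and> compact (closure (blinfun_apply F ` cball 0 1))}"

definition compact_ops_sphere :: "('h::complex_hilbert_space \<Rightarrow>\<^sub>L 'h) set" where
  "compact_ops_sphere = {F \<in> compact_ops. norm F = 1}"

text \<open>The functions on \<open>'h \<times> 'h\<close> carry the topology of pointwise convergence here.\<close>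

definition weak_operator_topology :: "('h::complex_hilbert_space \<Rightarrow>\<^sub>L 'h) topology" where
  "weak_operator_topology =
     pullback_topology UNIV (\<lambda>F. \<lambda>(x, y). cinner (blinfun_apply F x) y) euclidean"


section \<open>Dynamics of operators on the space of compact operators\<close>

text \<open>An operator on the compact operators is represented by a function \<open>T\<close> on all of \<open>'h \<Rightarrow>\<^sub>L 'h\<close>,
  of which only the restriction to \<^const>\<open>compact_ops\<close> matters.\<close>

definition bounded_operator_on_compact_ops ::
  "(('h::complex_hilbert_space \<Rightarrow>\<^sub>L 'h) \<Rightarrow> ('h \<Rightarrow>\<^sub>L 'h)) \<Rightarrow> bool" where
  "bounded_operator_on_compact_ops T \<longleftrightarrow>
     (\<forall>F\<in>compact_ops. T F \<in> compact_ops) \<and>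
     (\<forall>F\<in>compact_ops. \<forall>G\<in>compact_ops. T (F + G) = T F + T G) \<and>
     (\<forall>c. \<forall>F\<in>compact_ops. T (scaleC_op c F) = scaleC_op c (T F)) \<and>
     (\<exists>K. \<forall>F\<in>compact_ops. norm (T F) \<le> K * norm F)"

definition supercyclic ::
  "(('h::complex_hilbert_space \<Rightarrow>\<^sub>L 'h) \<Rightarrow> ('h \<Rightarrow>\<^sub>L 'h)) \<Rightarrow> bool" where
  "supercyclic T \<longleftrightarrow>
     (\<exists>F\<in>compact_ops.
        top_of_set compact_ops closure_of {scaleC_op c ((T ^^ n) F) | c n. True} = compact_ops)"

definition WOT_hypercyclic ::
  "(('h::complex_hilbert_space \<Rightarrow>\<^sub>L 'h) \<Rightarrow> ('h \<Rightarrow>\<^sub>L 'h)) \<Rightarrow> bool" where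
  "WOT_hypercyclic T \<longleftrightarrow>
     (\<exists>F\<in>compact_ops.
        subtopology weak_operator_topology compact_ops closure_of {(T ^^ n) F | n. True}
          = compact_ops)"

text \<open>In the two transitivity notions, the natural number \<open>n\<close> is positive.\<close>

definition topologically_Cstar_transitive ::
  "(('h::complex_hilbert_space \<Rightarrow>\<^sub>L 'h) \<Rightarrow> ('h \<Rightarrow>\<^sub>L 'h)) \<Rightarrow> bool" where
  "topologically_Cstar_transitive T \<longleftrightarrow>
     (\<forall>W V. openin (top_of_set (compact_ops_sphere \<times> compact_ops_sphere)) W \<and> W \<noteq> {} \<and>
        openin (top_of_set compact_ops) V \<and> V \<noteq> {} \<longrightarrow>
        (\<exists>n\<ge>1. \<exists>(A, B)\<in>W. adjoint_op B o\<^sub>L (T ^^ n) A \<in> V))"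

definition generalized_numerically_transitive ::
  "(('h::complex_hilbert_space \<Rightarrow>\<^sub>L 'h) \<Rightarrow> ('h \<Rightarrow>\<^sub>L 'h)) \<Rightarrow> bool" where
  "generalized_numerically_transitive T \<longleftrightarrow>
     (\<forall>W V. openin (top_of_set (compact_ops \<times> compact_ops)) W \<and> W \<noteq> {} \<and>
        openin (top_of_set compact_ops) V \<and> V \<noteq> {} \<longrightarrow>
        (\<exists>n\<ge>1. \<exists>(A, B)\<in>W. A o\<^sub>L (T ^^ n) B \<in> V))"

definition left_mult ::
  "('h::complex_hilbert_space \<Rightarrow>\<^sub>L 'h) \<Rightarrow> ('h \<Rightarrow>\<^sub>L 'h) \<Rightarrow> ('h \<Rightarrow>\<^sub>L 'h)" where
  "left_mult U F = U o\<^sub>L F"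

end

theory Submission
  imports Defs
begin

text \<open>Replacing \<open>F\<close> by \<open>U F\<close> doubles every norm \<open>\<parallel>F x\<parallel>\<close>, so the ratio of \<open>\<parallel>F x\<parallel>\<close> and \<open>\<parallel>F y\<parallel>\<close>
  is constant on projective orbits, which excludes supercyclicity. If \<open>F x \<noteq> 0\<close>, the norms of the vectors
  \<open>U\<^sup>n F x\<close> grow so fast that one vector has pairings bounded away from 0 with those of even index,
  and another one with those of odd index; hence 0 is not in the weak closure of the orbit.
  For the two transitivity properties, compact operators are approximated by their truncations,
  which the shift eventually makes orthogonal to each other. Small perturbations of both factors,
  supported far away, are multiplied by \<open>U\<^sup>n\<close> into any prescribed truncated operator.\<close>

section \<open>Complex inner products\<close>

lemma cinner_0_left: "cinner 0 (y :: 'h::complex_hilbert_space) = 0"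
  using cinner_add_left[of 0 0 y] by simp

lemma cinner_add_right:
  "cinner (x :: 'h::complex_hilbert_space) (y + z) = cinner x y + cinner x z"
  using cinner_commute[of x] by (simp add: cinner_add_left)

lemma cinner_scaleC_right:
  "cinner (x :: 'h::complex_hilbert_space) (c *\<^sub>C y) = cnj c * cinner x y"
  using cinner_commute[of x] by (simp add: cinner_scaleC_left)

lemma cinner_0_right: "cinner (x :: 'h::complex_hilbert_space) 0 = 0"
  using cinner_add_right[of x 0 0] by simp

lemma cinner_diff_left:
  "cinner (x - y) (z :: 'h::complex_hilbert_space) = cinner x z - cinner y z"
  using cinner_add_left[of "x - y" y z] by simp

lemma cinner_diff_right:
  "cinner (x :: 'h::complex_hilbert_space) (y - z) = cinner x y - cinner x z"
  using cinner_add_right[of x "y - z" z] by simp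

text \<open>The Cauchy-Schwarz inequality: for the orthogonal projection
  \<open>c *\<^sub>C y\<close> of \<open>x\<close> on the line through \<open>y\<close>, the squared
  norm of \<open>x - c *\<^sub>C y\<close> is nonnegative.\<close>

lemma norm_cinner_le: "cmod (cinner x y) \<le> norm x * norm (y :: 'h::complex_hilbert_space)"
proof (cases "y = 0")
  case True
  then show ?thesis by (simp add: cinner_0_right)
next
  case False
  define c where "c = cinner x y / complex_of_real ((norm y)\<^sup>2)"
  have ny: "complex_of_real ((norm y)\<^sup>2) \<noteq> 0"
    using False by simp
  have cy: "c * complex_of_real ((norm y)\<^sup>2) = cinner x y"
    unfolding c_def using ny by simp
  have "cinner (x - c *\<^sub>C y) (x - c *\<^sub>C y) =
      cinner x x - cnj c * cinner x y - c * cinner y x + cnj c * (c * cinner y y)"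
    by (simp add: cinner_diff_left cinner_diff_right cinner_scaleC_left cinner_scaleC_right
        algebra_simps)
  also have "c * cinner y y = cinner x y"
    using cy by (simp add: cinner_self)
  also have "cinner x x - cnj c * cinner x y - c * cinner y x + cnj c * cinner x y
      = cinner x x - c * cnj (cinner x y)"
    using cinner_commute[of y x] by simp
  also have "c * cnj (cinner x y) = complex_of_real ((cmod (cinner x y))\<^sup>2 / (norm y)\<^sup>2)"
    unfolding c_def by (simp add: complex_norm_square del: of_real_power)
  finally have "complex_of_real ((norm (x - c *\<^sub>C y))\<^sup>2)
      = complex_of_real ((norm x)\<^sup>2 - (cmod (cinner x y))\<^sup>2 / (norm y)\<^sup>2)"
    by (simp add: cinner_self)
  then have "(norm (x - c *\<^sub>C y))\<^sup>2 = (norm x)\<^sup>2 - (cmod (cinner x y))\<^sup>2 / (norm y)\<^sup>2"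
    using of_real_eq_iff by blast
  then have "(cmod (cinner x y))\<^sup>2 / (norm y)\<^sup>2 \<le> (norm x)\<^sup>2"
    by (metis diff_ge_0_iff_ge zero_le_power2)
  then have "(cmod (cinner x y))\<^sup>2 \<le> (norm x * norm y)\<^sup>2"
    using False by (simp add: divide_le_eq power_mult_distrib)
  then show ?thesis
    by (simp add: power2_le_iff_abs_le)
qed

text \<open>Conjugate-linearity in the second argument is still linearity over the reals, so the
  real notion of a bounded bilinear map applies. It supplies the rules for sums and limits.\<close>

lemma bounded_bilinear_cinner:
  "bounded_bilinear (cinner :: 'h::complex_hilbert_space \<Rightarrow> 'h \<Rightarrow> complex)"
proof
  show "\<exists>K. \<forall>a b :: 'h. cmod (cinner a b) \<le> norm a * norm b * K"
    using norm_cinner_le by (metis mult.right_neutral)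
qed (simp_all add: cinner_add_left cinner_add_right scaleR_scaleC cinner_scaleC_left
    cinner_scaleC_right scaleR_conv_of_real)

interpretation cinner: bounded_bilinear cinner
  by (rule bounded_bilinear_cinner)

lemma bounded_bilinear_scaleC:
  "bounded_bilinear (scaleC :: complex \<Rightarrow> 'h::complex_hilbert_space \<Rightarrow> 'h)"
proof
  show "\<exists>K. \<forall>a. \<forall>b :: 'h. norm (a *\<^sub>C b) \<le> norm a * norm b * K"
    by (metis norm_scaleC mult.right_neutral order_refl)
qed (simp_all add: scaleC_add_left scaleC_add_right scaleR_scaleC scaleC_scaleC
    scaleR_conv_of_real mult.commute)

interpretation scaleC: bounded_bilinear scaleC
  by (rule bounded_bilinear_scaleC)

lemma cinner_ext:
  assumes "\<And>x. cinner x a = cinner x (b :: 'h::complex_hilbert_space)"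
  shows "a = b"
proof -
  have "cinner (a - b) (a - b) = 0"
    using assms by (simp add: cinner_diff_right)
  then show ?thesis
    by (simp add: cinner_self)
qed

lemma norm_eq_if_cinner_eq:
  "cinner x x = cinner y y \<Longrightarrow> norm (x :: 'h::complex_hilbert_space) = norm (y :: 'h)"
  by (simp add: cinner_self flip: of_real_power)

section \<open>Complex-linear and compact operators\<close>

lemma clinear_op_iff:
  fixes F :: "'h::complex_hilbert_space \<Rightarrow>\<^sub>L 'h"
  shows "clinear_op F \<longleftrightarrow> (\<forall>c x. F (c *\<^sub>C x) = c *\<^sub>C F x)"
  using Vector_Spaces.linear_iff[of scaleC scaleC "blinfun_apply F"]
  by (simp add: scaleC_vector_space blinfun.add_right)

text \<open>A closed subset of a compact set is compact. In this form compactness is proved by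
  exhibiting any compact superset, and closures disappear from later proofs.\<close>

lemma compact_ops_iff:
  "F \<in> compact_ops \<longleftrightarrow> clinear_op F \<and> (\<exists>K. compact K \<and> blinfun_apply F ` cball 0 1 \<subseteq> K)"
proof -
  have "compact (closure X)" if "compact K" "X \<subseteq> K" for K X :: "'a set"
  proof -
    have "closure X \<subseteq> K"
      using that by (simp add: closure_minimal compact_imp_closed)
    then have "closure X = K \<inter> closure X"
      by blast
    then show ?thesis
      using compact_Int_closed[OF that(1) closed_closure[of X]] by simp
  qed
  then show ?thesis
    unfolding compact_ops_def using closure_subset[of "blinfun_apply F ` cball 0 1"] by auto
qed

lemma scaleC_op_apply [simp]: "scaleC_op c F x = c *\<^sub>C F x"
  by transfer simp

lemma compact_ops_add:
  assumes "F \<in> compact_ops" "G \<in> compact_ops"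
  shows "F + G \<in> compact_ops"
proof -
  obtain K L where K: "compact K" "blinfun_apply F ` cball 0 1 \<subseteq> K"
    and L: "compact L" "blinfun_apply G ` cball 0 1 \<subseteq> L"
    using assms by (auto simp: compact_ops_iff)
  have "blinfun_apply (F + G) ` cball 0 1 \<subseteq> {x + y |x y. x \<in> K \<and> y \<in> L}"
    using K L by (force simp: blinfun.add_left)
  moreover have "clinear_op (F + G)"
    using assms by (simp add: compact_ops_iff clinear_op_iff blinfun.add_left scaleC_add_right)
  ultimately show ?thesis
    using compact_sums[OF K(1) L(1)] by (auto simp: compact_ops_iff)
qed

lemma compact_ops_comp_left:
  assumes "clinear_op A" "F \<in> compact_ops"
  shows "A o\<^sub>L F \<in> compact_ops"
proof -
  obtain K where K: "compact K" "blinfun_apply F ` cball 0 1 \<subseteq> K"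
    using assms by (auto simp: compact_ops_iff)
  have "blinfun_apply (A o\<^sub>L F) ` cball 0 1 \<subseteq> A ` K"
    using K by auto
  moreover have "compact (A ` K)"
    by (intro compact_continuous_image K continuous_intros)
  ultimately show ?thesis
    using assms by (auto simp: compact_ops_iff clinear_op_iff)
qed

lemma compact_ops_scaleC_op:
  assumes "F \<in> compact_ops"
  shows "scaleC_op c F \<in> compact_ops"
proof -
  have "clinear_op (scaleC_op c id_blinfun)"
    by (simp add: clinear_op_iff scaleC_scaleC mult.commute)
  moreover have "scaleC_op c F = scaleC_op c id_blinfun o\<^sub>L F"
    by (rule blinfun_eqI) simp
  ultimately show ?thesis
    using compact_ops_comp_left[OF _ assms] by metis
qed

lemma compact_ops_scaleR:
  assumes "F \<in> compact_ops"
  shows "r *\<^sub>R F \<in> compact_ops"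
proof -
  have "r *\<^sub>R F = scaleC_op (complex_of_real r) F"
    by (rule blinfun_eqI) (simp add: blinfun.scaleR_left scaleR_scaleC)
  then show ?thesis
    using compact_ops_scaleC_op[OF assms] by simp
qed

lemma compact_ops_comp_right:
  assumes "clinear_op A" "F \<in> compact_ops"
  shows "F o\<^sub>L A \<in> compact_ops"
proof -
  obtain K where K: "compact K" "blinfun_apply F ` cball 0 1 \<subseteq> K"
    using assms by (auto simp: compact_ops_iff)
  \<comment> \<open>\<open>A\<close> maps the unit ball into the ball of radius \<open>r\<close>;
    the summand 1 makes \<open>r\<close> positive, so that dividing by it is harmless when
    \<open>A\<close> is 0.\<close>
  define r where "r = norm A + 1"
  have r: "r > 0"
    unfolding r_def by (simp add: add_nonneg_pos)
  have "F (A x) \<in> (*\<^sub>R) r ` K" if "norm x \<le> 1" for x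
  proof -
    have "norm (A x) \<le> norm A * norm x"
      by (rule norm_blinfun)
    also have "\<dots> \<le> r"
      using that mult_left_mono[OF that, of "norm A"] by (simp add: r_def)
    finally have "norm (A x /\<^sub>R r) \<le> 1"
      using r by (simp add: field_simps)
    then have "F (A x /\<^sub>R r) \<in> K"
      using K(2) by auto
    moreover have "F (A x) = r *\<^sub>R F (A x /\<^sub>R r)"
      using r by (simp add: blinfun.scaleR_right)
    ultimately show ?thesis
      by blast
  qed
  then have "blinfun_apply (F o\<^sub>L A) ` cball 0 1 \<subseteq> (*\<^sub>R) r ` K"
    by auto
  moreover have "clinear_op (F o\<^sub>L A)"
    using assms by (simp add: compact_ops_iff clinear_op_iff)
  ultimately show ?thesis
    using compact_scaling[OF K(1)] unfolding compact_ops_iff by blast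
qed

section \<open>Rank-one operators\<close>

lift_definition rank1 :: "'h::complex_hilbert_space \<Rightarrow> 'h \<Rightarrow> ('h \<Rightarrow>\<^sub>L 'h)"
  is "\<lambda>a b x. cinner x a *\<^sub>C b"
  by (rule bounded_linear_compose[OF scaleC.bounded_linear_left cinner.bounded_linear_left])

declare rank1.rep_eq [simp]

lemma rank1_compact: "rank1 a b \<in> compact_ops"
proof -
  have "compact ((\<lambda>c. c *\<^sub>C b) ` cball 0 (norm a))"
    by (intro compact_continuous_image linear_continuous_on scaleC.bounded_linear_left) simp
  moreover have "cmod (cinner x a) \<le> norm a" if "norm x \<le> 1" for x
    using norm_cinner_le[of x a] mult_right_mono[OF that, of "norm a"] by simp
  then have "blinfun_apply (rank1 a b) ` cball 0 1 \<subseteq> (\<lambda>c. c *\<^sub>C b) ` cball 0 (norm a)"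
    by auto
  moreover have "clinear_op (rank1 a b)"
    unfolding clinear_op_iff by (simp add: cinner_scaleC_left scaleC_scaleC)
  ultimately show ?thesis
    unfolding compact_ops_iff by blast
qed

lemma norm_rank1_le: "norm (rank1 a b) \<le> norm a * norm b"
proof (rule norm_blinfun_bound)
  fix x
  show "norm (rank1 a b x) \<le> norm a * norm b * norm x"
    using mult_right_mono[OF norm_cinner_le[of x a], of "norm b"]
    by (simp add: norm_scaleC mult_ac)
qed simp

lemma compact_ops_zero: "0 \<in> compact_ops"
  using compact_ops_scaleR[OF rank1_compact, of 0] by simp

lemma compact_ops_sum:
  "(\<And>i. i \<in> I \<Longrightarrow> f i \<in> compact_ops) \<Longrightarrow> sum f I \<in> compact_ops"
  by (induction I rule: infinite_finite_induct) (auto intro: compact_ops_add compact_ops_zero)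

lemma clinear_op_compact: "F \<in> compact_ops \<Longrightarrow> clinear_op F"
  by (simp add: compact_ops_iff)

text \<open>The definite description is resolved by uniqueness, which is \<open>cinner_ext\<close>;
  existence is the hypothesis.\<close>

lemma adjoint_op_eqI:
  fixes F G :: "'h::complex_hilbert_space \<Rightarrow>\<^sub>L 'h"
  assumes "\<And>x y. cinner (F x) y = cinner x (G y)"
  shows "adjoint_op F = G"
  unfolding adjoint_op_def
proof (rule the_equality)
  fix G' assume "\<forall>x y. cinner (F x) y = cinner x (blinfun_apply G' y)"
  then show "G' = G"
    using assms by (intro blinfun_eqI cinner_ext) simp
qed (use assms in simp)

section \<open>Truncated shifts\<close>

lemma norm_blinfun_le_on_ball:
  fixes F :: "'a::real_normed_vector \<Rightarrow>\<^sub>L 'b::real_normed_vector"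
  assumes "0 \<le> c" "\<And>x. norm x \<le> 1 \<Longrightarrow> norm (F x) \<le> c"
  shows "norm F \<le> c"
proof (rule norm_blinfun_bound[OF assms(1)])
  fix x
  show "norm (F x) \<le> c * norm x"
  proof (cases "x = 0")
    case False
    then have "norm (F (x /\<^sub>R norm x)) \<le> c"
      by (intro assms) simp
    then show ?thesis
      using False by (simp add: blinfun.scaleR_right field_simps)
  qed (simp add: blinfun.zero_right)
qed

locale int_orthonormal_basis =
  fixes e :: "int \<Rightarrow> 'h::complex_hilbert_space"
  assumes orthonormal_basis: "orthonormal_basis e"
begin

lemma cinner_basis: "cinner (e i) (e j) = (if i = j then 1 else 0)"
  using orthonormal_basis by (auto simp: orthonormal_basis_def)

text \<open>For the unitary shift \<open>S\<close> and the projection \<open>P n\<close> onto the span of the \<open>e i\<close> with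
  \<open>\<bar>i\<bar> \<le> n\<close>, this is \<open>S\<^sup>b P n S\<^sup>-\<^sup>a\<close>.\<close>

definition trunc_shift :: "nat \<Rightarrow> int \<Rightarrow> int \<Rightarrow> ('h \<Rightarrow>\<^sub>L 'h)" where
  "trunc_shift n a b = (\<Sum>i\<in>{- int n..int n}. rank1 (e (i + a)) (e (i + b)))"

abbreviation P :: "nat \<Rightarrow> ('h \<Rightarrow>\<^sub>L 'h)" where
  "P n \<equiv> trunc_shift n 0 0"

lemma trunc_shift_apply:
  "trunc_shift n a b x = (\<Sum>i\<in>{- int n..int n}. cinner x (e (i + a)) *\<^sub>C e (i + b))"
  by (simp add: trunc_shift_def blinfun.sum_left)

lemma trunc_shift_compact: "trunc_shift n a b \<in> compact_ops"
  unfolding trunc_shift_def by (intro compact_ops_sum rank1_compact)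

text \<open>The adjoint of a rank-one operator exchanges its two vectors, so that of a truncated
  shift exchanges \<open>a\<close> and \<open>b\<close>. In particular \<open>P n\<close> is
  self-adjoint.\<close>

lemma cinner_trunc_shift: "cinner (trunc_shift n a b x) y = cinner x (trunc_shift n b a y)"
  by (simp add: trunc_shift_apply cinner.sum_left cinner.sum_right cinner_scaleC_left
      cinner_scaleC_right flip: cinner_commute)
    (simp add: mult.commute)

lemma cinner_trunc_shift_basis:
  "cinner (trunc_shift n a b x) (e k) =
    (if k - b \<in> {- int n..int n} then cinner x (e (k - b + a)) else 0)"
proof -
  have "cinner (trunc_shift n a b x) (e k) =
      (\<Sum>i\<in>{- int n..int n}. if k - b = i then cinner x (e (i + a)) else 0)"
    unfolding trunc_shift_apply cinner.sum_left cinner_scaleC_left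
    by (rule sum.cong) (auto simp: cinner_basis)
  then show ?thesis
    by (simp add: sum.delta')
qed

text \<open>The inner shifts cancel and the projection is idempotent.\<close>

lemma trunc_shift_trunc_shift: "trunc_shift n b c (trunc_shift n a b x) = trunc_shift n a c x"
  unfolding trunc_shift_apply[of n b c] trunc_shift_apply[of n a c]
  by (rule sum.cong) (auto simp: cinner_trunc_shift_basis)

text \<open>Index windows of radius \<open>n\<close> around \<open>b\<close> and \<open>c\<close>
  are disjoint once their centres are more than \<open>2 * n\<close> apart, so the two spans are
  orthogonal.\<close>

lemma trunc_shift_trunc_shift_far:
  assumes "2 * int n < \<bar>b - c\<bar>"
  shows "trunc_shift n c d (trunc_shift n a b x) = 0"
  unfolding trunc_shift_apply[of n c]
  using assms by (intro sum.neutral) (auto simp: cinner_trunc_shift_basis scaleC.zero_left)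

text \<open>Both squared norms equal \<open>cinner x (trunc_shift n a a x)\<close>.\<close>

lemma norm_trunc_shift_eq: "norm (trunc_shift n a b x) = norm (trunc_shift n a c x)"
  by (rule norm_eq_if_cinner_eq) (simp add: cinner_trunc_shift trunc_shift_trunc_shift)

lemma norm_trunc_shift_apply_le: "norm (trunc_shift n a b x) \<le> norm x"
proof -
  \<comment> \<open>By \<open>norm_trunc_shift_eq\<close> the case \<open>b = a\<close> suffices,
    where the operator is an orthogonal projection.\<close>
  let ?y = "trunc_shift n a a x"
  have "cinner ?y ?y = cinner x ?y"
    by (simp add: cinner_trunc_shift trunc_shift_trunc_shift)
  then have "(norm ?y)\<^sup>2 = cmod (cinner x ?y)"
    by (metis cinner_self norm_of_real abs_of_nonneg zero_le_power2)
  also have "\<dots> \<le> norm x * norm ?y"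
    by (rule norm_cinner_le)
  finally have "norm ?y \<le> norm x"
    by (cases "norm ?y = 0") (auto simp: power2_eq_square)
  then show ?thesis
    using norm_trunc_shift_eq[of n a b x a] by simp
qed

lemma norm_trunc_shift_le: "norm (trunc_shift n a b) \<le> 1"
  by (rule norm_blinfun_bound) (auto simp: norm_trunc_shift_apply_le)

text \<open>As \<open>P n\<close> is a contraction, good approximation at \<open>y\<close> passes to
  nearby \<open>x\<close>, uniformly in \<open>n\<close>.\<close>

lemma P_approx: "norm (P n x - x) \<le> norm (P n y - y) + 2 * norm (x - y)"
proof -
  have "P n x - x = (P n y - y) + (P n (x - y) + (y - x))"
    by (simp add: blinfun.diff_right)
  also have "norm \<dots> \<le> norm (P n y - y) + (norm (P n (x - y)) + norm (y - x))"
    by (intro norm_triangle_le add_left_mono norm_triangle_ineq)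
  finally show ?thesis
    using norm_trunc_shift_apply_le[of n 0 0 "x - y"] by (simp add: norm_minus_commute)
qed

text \<open>The vectors with this convergence form a closed complex subspace containing the basis,
  hence everything.\<close>

lemma P_tendsto: "(\<lambda>n. P n x) \<longlonglongrightarrow> x"
proof -
  interpret vector_space "scaleC :: complex \<Rightarrow> 'h \<Rightarrow> 'h"
    by (rule scaleC_vector_space)
  let ?M = "{x. (\<lambda>n. P n x) \<longlonglongrightarrow> x}"
  have "e k \<in> ?M" for k
  proof -
    have "P n (e k) = e k" if "n \<ge> nat \<bar>k\<bar>" for n
    proof -
      have "P n (e k) = (\<Sum>i\<in>{- int n..int n}. if k = i then e i else 0)"
        unfolding trunc_shift_apply
        by (rule sum.cong) (auto simp: cinner_basis scaleR_scaleC[of 1, simplified, symmetric]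
            scaleC.zero_left)
      also have "\<dots> = e k"
        using that by (subst sum.delta') auto
      finally show ?thesis .
    qed
    then have "\<forall>\<^sub>F n in sequentially. P n (e k) = e k"
      unfolding eventually_sequentially by blast
    then show ?thesis
      by (simp add: tendsto_eventually)
  qed
  moreover have "subspace ?M"
  proof (rule subspaceI)
    show "c *\<^sub>C x \<in> ?M" if "x \<in> ?M" for c x
    proof -
      have "P n (c *\<^sub>C x) = c *\<^sub>C P n x" for n
        using clinear_op_compact[OF trunc_shift_compact] unfolding clinear_op_iff by blast
      then show ?thesis
        using that scaleC.tendsto[OF tendsto_const[of c]] by simp
    qed
  qed (auto simp: blinfun.zero_right blinfun.add_right intro: tendsto_add)
  ultimately have "span (range e) \<subseteq> ?M"
    by (intro span_minimal) auto
  moreover have "closed ?M"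
  proof -
    have "x \<in> ?M" if "x \<in> closure ?M" for x
    proof -
      have "\<exists>N. \<forall>n\<ge>N. norm (P n x - x) < r" if "r > 0" for r
      proof -
        obtain y where y: "y \<in> ?M" "dist y x < r / 3"
          using \<open>x \<in> closure ?M\<close> \<open>r > 0\<close> closure_approachable[of x ?M]
          by (meson divide_pos_pos zero_less_numeral)
        obtain N where N: "\<And>n. n \<ge> N \<Longrightarrow> norm (P n y - y) < r / 3"
          using y(1) \<open>r > 0\<close> LIMSEQ_D[of "\<lambda>n. P n y" y "r / 3"] by auto
        have "norm (P n x - x) < r" if "n \<ge> N" for n
          using P_approx[of n x y] N[OF that] y(2) by (simp add: dist_norm norm_minus_commute)
        then show ?thesis
          by blast
      qed
      then show ?thesis
        by (simp add: LIMSEQ_iff)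
    qed
    then show ?thesis
      using closure_subset_eq[of ?M] by blast
  qed
  ultimately have "closure (span (range e)) \<subseteq> ?M"
    by (rule closure_minimal)
  then show ?thesis
    using orthonormal_basis unfolding orthonormal_basis_def by blast
qed

section \<open>Adjoints and approximation by truncation\<close>

text \<open>Pointwise convergence of the contractions \<open>P n\<close> is uniform on compact sets,
  in particular on the image of the unit ball under \<open>F\<close>.\<close>

lemma P_comp_tendsto:
  assumes "F \<in> compact_ops"
  shows "(\<lambda>n. P n o\<^sub>L F) \<longlonglongrightarrow> F"
proof (rule LIMSEQ_I)
  fix r :: real
  assume r: "r > 0"
  obtain K where K: "compact K" "blinfun_apply F ` cball 0 1 \<subseteq> K"
    using assms by (auto simp: compact_ops_iff)
  \<comment> \<open>A finite net of mesh \<open>r / 6\<close>: \<open>P_approx\<close> counts the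
    distance to the net twice, which gives \<open>r / 6 + 2 * (r / 6) = r / 2\<close>.\<close>
  obtain k where k: "finite k" "k \<subseteq> K" "K \<subseteq> (\<Union>y\<in>k. ball y (r / 6))"
    using compactE_image[OF K(1), of K "\<lambda>y. ball y (r / 6)"] r by force
  have "\<forall>y\<in>k. \<forall>\<^sub>F n in sequentially. norm (P n y - y) < r / 6"
    using LIMSEQ_D[OF P_tendsto, of "r / 6"] r by (simp add: eventually_sequentially)
  then have "\<forall>\<^sub>F n in sequentially. \<forall>y\<in>k. norm (P n y - y) < r / 6"
    by (rule eventually_ball_finite[OF k(1)])
  then obtain N where N: "\<And>n y. n \<ge> N \<Longrightarrow> y \<in> k \<Longrightarrow> norm (P n y - y) < r / 6"
    by (auto simp: eventually_sequentially)
  have "norm ((P n o\<^sub>L F) - F) < r" if "n \<ge> N" for n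
  proof -
    have "norm (((P n o\<^sub>L F) - F) x) \<le> r / 2" if "norm x \<le> 1" for x
    proof -
      have "F x \<in> K"
        using K(2) that by auto
      then obtain y where y: "y \<in> k" "dist y (F x) < r / 6"
        using k(3) by auto
      then show ?thesis
        using P_approx[of n "F x" y] N[OF \<open>n \<ge> N\<close> y(1)]
        by (simp add: blinfun.diff_left dist_norm norm_minus_commute)
    qed
    then have "norm ((P n o\<^sub>L F) - F) \<le> r / 2"
      using r by (intro norm_blinfun_le_on_ball) auto
    then show ?thesis
      using r by simp
  qed
  then show "\<exists>N. \<forall>n\<ge>N. norm ((P n o\<^sub>L F) - F) < r"
    by blast
qed

section \<open>Riesz representation and existence of adjoints\<close>

lemma norm_sum_basis:
  assumes "finite I"
  shows "(norm (\<Sum>i\<in>I. c i *\<^sub>C e i))\<^sup>2 = (\<Sum>i\<in>I. (cmod (c i))\<^sup>2)"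
proof -
  have "cinner (\<Sum>i\<in>I. c i *\<^sub>C e i) (\<Sum>i\<in>I. c i *\<^sub>C e i)
      = (\<Sum>i\<in>I. c i * (\<Sum>j\<in>I. if i = j then cnj (c j) else 0))"
    unfolding cinner.sum_left cinner_scaleC_left unfolding cinner.sum_right
    by (intro sum.cong refl arg_cong2[where f = "(*)"]) (auto simp: cinner_scaleC_right cinner_basis)
  also have "\<dots> = complex_of_real (\<Sum>i\<in>I. (cmod (c i))\<^sup>2)"
    using assms by (simp add: complex_norm_square del: of_real_power)
  finally show ?thesis
    unfolding cinner_self using of_real_eq_iff by blast
qed

text \<open>The vectors \<open>y n\<close> represent \<open>f\<close> on truncations. Their squared
  norms \<open>s n\<close> increase and stay bounded, and by orthogonality differences of
  \<open>s\<close> control those of \<open>y\<close>, so \<open>y\<close> is Cauchy; its limit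
  represents \<open>f\<close>.\<close>

lemma riesz_representation:
  fixes f :: "'h \<Rightarrow> complex"
  assumes "bounded_linear f" and scale: "\<And>c x. f (c *\<^sub>C x) = c * f x"
  shows "\<exists>y. \<forall>x. f x = cinner x y"
proof -
  interpret f: bounded_linear f by fact
  define y where "y n = (\<Sum>i\<in>{- int n..int n}. cnj (f (e i)) *\<^sub>C e i)" for n :: nat
  define s where "s n = (\<Sum>i\<in>{- int n..int n}. (cmod (f (e i)))\<^sup>2)" for n :: nat
  have fP: "f (P n x) = cinner x (y n)" for n x
    by (simp add: trunc_shift_apply y_def f.sum scale cinner.sum_right cinner_scaleC_right mult.commute)
  have diff: "(norm (y m - y n))\<^sup>2 = s n - s m" if "m \<le> n" for m n
  proof -
    have sub: "{- int m..int m} \<subseteq> {- int n..int n}"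
      using that by auto
    have "y n - y m = (\<Sum>i\<in>{- int n..int n} - {- int m..int m}. cnj (f (e i)) *\<^sub>C e i)"
      unfolding y_def using sub by (simp add: sum_diff)
    then have "(norm (y n - y m))\<^sup>2
        = (\<Sum>i\<in>{- int n..int n} - {- int m..int m}. (cmod (f (e i)))\<^sup>2)"
      by (simp add: norm_sum_basis)
    also have "\<dots> = s n - s m"
      unfolding s_def using sub by (simp add: sum_diff)
    finally show ?thesis
      by (simp add: norm_minus_commute)
  qed
  obtain C where C: "\<And>x. norm (f x) \<le> norm x * C" "C \<ge> 0"
    using f.nonneg_bounded by blast
  have "s n \<le> C\<^sup>2" for n
  proof -
    \<comment> \<open>Testing the functional on its own representing vector yields
      \<open>norm (y n) \<le> C\<close>.\<close>
    have "(norm (y n))\<^sup>2 = norm (f (P n (y n)))"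
      unfolding fP cinner_self by (simp del: of_real_power)
    also have "\<dots> \<le> norm (P n (y n)) * C"
      by (rule C)
    also have "\<dots> \<le> norm (y n) * C"
      by (intro mult_right_mono norm_trunc_shift_apply_le C)
    finally have "norm (y n) \<le> C"
      using C(2) by (cases "norm (y n) = 0") (auto simp: power2_eq_square)
    then have "(norm (y n))\<^sup>2 \<le> C\<^sup>2"
      by (simp add: power_mono)
    then show ?thesis
      by (simp add: y_def s_def norm_sum_basis)
  qed
  moreover have "incseq s"
  proof (rule incseq_SucI)
    show "s n \<le> s (Suc n)" for n
      using diff[of n "Suc n"] zero_le_power2[of "norm (y n - y (Suc n))"] by linarith
  qed
  ultimately obtain l where "s \<longlonglongrightarrow> l"
    using incseq_convergent by metis
  then have Cs: "Cauchy s"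
    by (rule LIMSEQ_imp_Cauchy)
  have "Cauchy y"
  proof (rule CauchyI')
    fix r :: real
    assume r: "r > 0"
    then obtain M where M: "\<And>m n. m \<ge> M \<Longrightarrow> n \<ge> M \<Longrightarrow> norm (s m - s n) < r\<^sup>2"
      using CauchyD[OF Cs, of "r\<^sup>2"] by auto
    have "norm (y m - y n) < r" if "m \<ge> M" "n > m" for m n
    proof (rule power_less_imp_less_base)
      show "(norm (y m - y n))\<^sup>2 < r\<^sup>2"
        using M[of n m] diff[of m n] that by simp
    qed (use r in simp)
    then show "\<exists>M. \<forall>m\<ge>M. \<forall>n>m. dist (y m) (y n) < r"
      unfolding dist_norm by blast
  qed
  then obtain z where z: "y \<longlonglongrightarrow> z"
    using Cauchy_convergent convergent_def by blast
  have "f x = cinner x z" for x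
  proof (rule LIMSEQ_unique)
    show "(\<lambda>n. f (P n x)) \<longlonglongrightarrow> f x"
      by (intro f.tendsto P_tendsto)
    show "(\<lambda>n. f (P n x)) \<longlonglongrightarrow> cinner x z"
      unfolding fP by (intro cinner.tendsto tendsto_const z)
  qed
  then show ?thesis
    by blast
qed

text \<open>Riesz representation gives the value of the adjoint at each \<open>y\<close>; linearity
  follows from \<open>cinner_ext\<close>, and boundedness from pairing \<open>g y\<close> with
  itself.\<close>

lemma cinner_adjoint_op:
  fixes F :: "'h \<Rightarrow>\<^sub>L 'h"
  assumes "clinear_op F"
  shows "cinner (F x) y = cinner x (adjoint_op F y)"
proof -
  have "\<exists>z. \<forall>x. cinner (F x) y = cinner x z" for y
    using assms
    by (intro riesz_representation bounded_linear_compose[OF cinner.bounded_linear_left]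
        blinfun.bounded_linear_right) (simp add: clinear_op_iff cinner_scaleC_left)
  then obtain g where g: "\<And>x y. cinner (F x) y = cinner x (g y)"
    by metis
  have "bounded_linear g"
  proof (rule bounded_linear_intro[where K = "norm F"])
    show "g (y + z) = g y + g z" for y z
      by (rule cinner_ext) (simp add: cinner_add_right flip: g)
    show "g (r *\<^sub>R y) = r *\<^sub>R g y" for r y
      by (rule cinner_ext) (simp add: cinner.scaleR_right flip: g)
    show "norm (g y) \<le> norm y * norm F" for y
    proof -
      have "(norm (g y))\<^sup>2 = cmod (cinner (F (g y)) y)"
        unfolding g cinner_self by (simp del: of_real_power)
      also have "\<dots> \<le> norm (F (g y)) * norm y"
        by (rule norm_cinner_le)
      also have "\<dots> \<le> norm F * norm (g y) * norm y"
        by (intro mult_right_mono norm_blinfun) simp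
      finally show ?thesis
        by (cases "norm (g y) = 0") (auto simp: power2_eq_square mult_ac)
    qed
  qed
  then have "blinfun_apply (Blinfun g) = g"
    by (rule bounded_linear_Blinfun_apply)
  moreover from this have "adjoint_op F = Blinfun g"
    by (intro adjoint_op_eqI) (simp add: g)
  ultimately show ?thesis
    by (simp add: g)
qed

text \<open>Composition with \<open>P n\<close> on the right is contractive, so the property is
  preserved under norm limits.\<close>

lemma comp_P_tendsto_limit:
  assumes "G \<longlonglongrightarrow> F" "\<And>j. (\<lambda>n. G j o\<^sub>L P n) \<longlonglongrightarrow> G j"
  shows "(\<lambda>n. F o\<^sub>L P n) \<longlonglongrightarrow> F"
proof (rule LIMSEQ_I)
  fix r :: real
  assume r: "r > 0"
  obtain j where j: "norm (G j - F) < r / 3"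
    using LIMSEQ_D[OF assms(1), of "r / 3"] r by auto
  obtain N where N: "\<And>n. n \<ge> N \<Longrightarrow> norm ((G j o\<^sub>L P n) - G j) < r / 3"
    using LIMSEQ_D[OF assms(2)[of j], of "r / 3"] r by auto
  have "norm ((F o\<^sub>L P n) - F) < r" if "n \<ge> N" for n
  proof -
    have "(F o\<^sub>L P n) - F = ((G j o\<^sub>L P n) - G j) + ((G j - F) + ((F - G j) o\<^sub>L P n))"
      by (rule blinfun_eqI) (simp add: blinfun.diff_left blinfun.add_left)
    also have "norm \<dots> \<le> norm ((G j o\<^sub>L P n) - G j) + (norm (G j - F) + norm ((F - G j) o\<^sub>L P n))"
      by (intro norm_triangle_le add_left_mono norm_triangle_ineq)
    also have "norm ((F - G j) o\<^sub>L P n) \<le> norm (F - G j) * 1"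
      by (rule order_trans[OF norm_blinfun_compose mult_left_mono[OF norm_trunc_shift_le]]) simp
    finally show ?thesis
      using j N[OF that] by (simp add: norm_minus_commute)
  qed
  then show "\<exists>N. \<forall>n\<ge>N. norm ((F o\<^sub>L P n) - F) < r"
    by blast
qed

text \<open>Self-adjointness moves \<open>P n\<close> onto the vector \<open>a\<close>, reducing the
  claim to \<open>P_tendsto\<close>.\<close>

lemma rank1_comp_P_tendsto: "(\<lambda>n. rank1 a b o\<^sub>L P n) \<longlonglongrightarrow> rank1 a b"
proof (rule LIM_zero_cancel, rule Lim_null_comparison)
  have "(rank1 a b o\<^sub>L P n) - rank1 a b = rank1 (P n a - a) b" for n
    by (rule blinfun_eqI)
      (simp add: blinfun.diff_left cinner_trunc_shift cinner_diff_right scaleC.diff_left)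
  then show "\<forall>\<^sub>F n in sequentially. norm ((rank1 a b o\<^sub>L P n) - rank1 a b) \<le> norm (P n a - a) * norm b"
    by (simp add: norm_rank1_le)
  show "(\<lambda>n. norm (P n a - a) * norm b) \<longlonglongrightarrow> 0"
    by (intro tendsto_mult_left_zero tendsto_norm_zero LIM_zero P_tendsto)
qed

lemma comp_P_tendsto:
  assumes "F \<in> compact_ops"
  shows "(\<lambda>n. F o\<^sub>L P n) \<longlonglongrightarrow> F"
proof (rule comp_P_tendsto_limit[OF P_comp_tendsto[OF assms]])
  fix j
  \<comment> \<open>The operators \<open>P j o\<^sub>L F\<close> approximate \<open>F\<close> and
    are finite sums of rank-one operators, as the adjoint moves \<open>F\<close> onto the basis
    vectors.\<close>
  have "P j o\<^sub>L F = (\<Sum>i\<in>{- int j..int j}. rank1 (adjoint_op F (e i)) (e i))"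
    by (rule blinfun_eqI)
      (simp add: trunc_shift_apply blinfun.sum_left cinner_adjoint_op clinear_op_compact assms)
  then show "(\<lambda>n. P j o\<^sub>L F o\<^sub>L P n) \<longlonglongrightarrow> (P j o\<^sub>L F)"
    by (simp add: bounded_bilinear.sum_left[OF bounded_bilinear_blinfun_compose] tendsto_sum rank1_comp_P_tendsto)
qed

end

section \<open>The doubled shift\<close>

text \<open>Here \<open>(left_mult U ^^ n) id_blinfun\<close> stands for the operator power of
  \<open>U\<close>.\<close>

lemma left_mult_funpow:
  "(left_mult U ^^ n) F = (left_mult U ^^ n) id_blinfun o\<^sub>L F"
  by (induction n) (auto simp: left_mult_def intro!: blinfun_eqI)

lemma clinear_op_left_mult_funpow:
  assumes "clinear_op U"
  shows "clinear_op ((left_mult U ^^ n) id_blinfun)"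
proof (induction n)
  case 0
  then show ?case
    unfolding clinear_op_iff by simp
next
  case (Suc n)
  then show ?case
    using assms unfolding clinear_op_iff by (simp add: left_mult_def)
qed

lemma bounded_operator_on_compact_ops_left_mult:
  assumes "clinear_op U"
  shows "bounded_operator_on_compact_ops (left_mult U)"
  unfolding bounded_operator_on_compact_ops_def
proof (intro conjI ballI allI exI)
  fix F :: "'a \<Rightarrow>\<^sub>L 'a"
  show "left_mult U F \<in> compact_ops" if "F \<in> compact_ops"
    using that assms by (simp add: left_mult_def compact_ops_comp_left)
  show "left_mult U (F + G) = left_mult U F + left_mult U G" for G
    by (simp add: left_mult_def bounded_bilinear.add_right[OF bounded_bilinear_blinfun_compose])
  show "left_mult U (scaleC_op c F) = scaleC_op c (left_mult U F)" for c
    using assms by (intro blinfun_eqI) (simp add: left_mult_def clinear_op_iff)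
  show "norm (left_mult U F) \<le> norm U * norm F"
    by (simp add: left_mult_def norm_blinfun_compose)
qed

locale doubled_shift = int_orthonormal_basis e
  for e :: "int \<Rightarrow> 'h::complex_hilbert_space" +
  fixes S U :: "'h \<Rightarrow>\<^sub>L 'h"
  assumes S_clinear: "clinear_op S" and S_basis: "\<And>j. S (e j) = e (j + 1)"
    and U_eq: "U = 2 *\<^sub>R S"
begin

abbreviation T :: "nat \<Rightarrow> ('h \<Rightarrow>\<^sub>L 'h) \<Rightarrow> ('h \<Rightarrow>\<^sub>L 'h)" where
  "T n \<equiv> left_mult U ^^ n"

lemma U_clinear: "clinear_op U"
  using S_clinear unfolding U_eq clinear_op_iff
  by (simp add: blinfun.scaleR_left scaleR_scaleC scaleC_scaleC mult.commute)

lemma S_trunc_shift: "S (trunc_shift n a b x) = trunc_shift n a (b + 1) x"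
  using S_clinear
  by (simp add: trunc_shift_apply blinfun.sum_right clinear_op_iff S_basis add.assoc)

text \<open>\<open>S\<close> is prescribed only on the basis; it is isometric on truncations, and
  these are dense.\<close>

lemma norm_S: "norm (S x) = norm x"
proof (rule LIMSEQ_unique)
  show "(\<lambda>n. norm (S (P n x))) \<longlonglongrightarrow> norm (S x)"
    by (intro tendsto_norm blinfun.tendsto tendsto_const P_tendsto)
  have "norm (S (P n x)) = norm (P n x)" for n
    unfolding S_trunc_shift by (rule norm_trunc_shift_eq)
  then show "(\<lambda>n. norm (S (P n x))) \<longlonglongrightarrow> norm x"
    by (simp add: tendsto_norm P_tendsto)
qed

text \<open>The factor depends neither on \<open>F\<close> nor on \<open>x\<close>; both negative
  results rest on this.\<close>

lemma norm_T_apply: "norm (T n F x) = 2 ^ n * norm (F x)"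
  by (induction n) (auto simp: left_mult_def U_eq blinfun.scaleR_left norm_S)

lemma T_trunc_shift:
  "T m id_blinfun (trunc_shift n a b x) = 2 ^ m *\<^sub>R trunc_shift n a (b + int m) x"
  by (induction m)
    (auto simp: left_mult_def U_eq blinfun.scaleR_left blinfun.scaleR_right S_trunc_shift algebra_simps)

subsection \<open>Supercyclicity\<close>

lemma rank1_basis_apply: "rank1 (e i) (e j) (e k) = (if k = i then e j else 0)"
  using scaleR_scaleC[of 1 "e j"] by (simp add: cinner_basis scaleC.zero_left)

lemma basis_nonzero: "e j \<noteq> 0"
  using cinner_basis[of j j] by (auto simp: cinner_0_left)

lemma not_supercyclic: "\<not> supercyclic (left_mult U)"
proof
  assume "supercyclic (left_mult U)"
  then obtain F where F: "top_of_set compact_ops closure_of {scaleC_op c (T n F) |c n. True} = compact_ops"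
    unfolding supercyclic_def by blast
  \<comment> \<open>Density in the form used: a closed condition valid on the projective orbit holds
    for all compact operators.\<close>
  have dense: "G \<in> R"
    if "closed R" "\<And>c n. scaleC_op c (T n F) \<in> R" "G \<in> compact_ops" for R G
  proof -
    have "G \<in> closure {scaleC_op c (T n F) |c n. True}"
      using F that(3) closure_of_subtopology_subset[of euclidean compact_ops] by fastforce
    moreover have "closure {scaleC_op c (T n F) |c n. True} \<subseteq> R"
      using that by (intro closure_minimal) auto
    ultimately show ?thesis
      by blast
  qed
  have ratio: "norm (G (e 0)) * norm (F (e 1)) = norm (G (e 1)) * norm (F (e 0))"
    if "G \<in> compact_ops" for G
  proof -
    let ?R = "{G. norm (blinfun_apply G (e 0)) * norm (F (e 1)) = norm (G (e 1)) * norm (F (e 0))}"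
    have "closed ?R"
      by (intro closed_Collect_eq continuous_intros)
    then have "G \<in> ?R"
      by (rule dense[OF _ _ that]) (simp add: norm_scaleC norm_T_apply)
    then show ?thesis
      by simp
  qed
  \<comment> \<open>The test operator kills \<open>e 0\<close> but not \<open>e 1\<close>. So
    \<open>F\<close> vanishes at \<open>e 0\<close>, and by density every compact operator would
    too.\<close>
  have "norm (F (e 0)) = 0"
    using ratio[OF rank1_compact[of "e 1" "e 0"]] basis_nonzero by (simp add: rank1_basis_apply del: rank1.rep_eq)
  have "closed {G. blinfun_apply G (e 0) = 0}"
    by (intro closed_Collect_eq continuous_intros)
  moreover have "scaleC_op c (T n F) (e 0) = 0" for c n
    using norm_T_apply[of n F "e 0"] \<open>norm (F (e 0)) = 0\<close> by (simp add: scaleC.zero_right)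
  ultimately have "rank1 (e 0) (e 0) (e 0) = 0"
    using dense[of "{G. blinfun_apply G (e 0) = 0}", OF _ _ rank1_compact[of "e 0" "e 0"]] by simp
  then show False
    using basis_nonzero by (simp add: rank1_basis_apply del: rank1.rep_eq)
qed

subsection \<open>Weak hypercyclicity\<close>

lemma continuous_map_WOT:
  fixes x y :: 'h
  shows "continuous_map weak_operator_topology euclidean (\<lambda>F. cinner (blinfun_apply F x) y)"
proof -
  have "continuous_map euclidean euclidean (\<lambda>f :: 'h \<times> 'h \<Rightarrow> complex. f (x, y))"
    by simp
  from continuous_map_pullback[OF this, of UNIV "\<lambda>F (x, y). cinner (blinfun_apply F x) y"]
  show ?thesis
    by (simp add: weak_operator_topology_def o_def)
qed

text \<open>Two functionals are controlled by one and the same \<open>n\<close>, since the parity of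
  that \<open>n\<close> decides later which of them gives the contradiction.\<close>

lemma WOT_hypercyclic_approx:
  assumes "subtopology weak_operator_topology compact_ops closure_of {T n F |n. True} = compact_ops"
    and "G \<in> compact_ops" "r > 0"
  shows "\<exists>n. cmod (cinner (T n F x) y - cinner (G x) y) < r \<and>
    cmod (cinner (T n F x) z - cinner (G x) z) < r"
proof -
  let ?X = "weak_operator_topology :: ('h \<Rightarrow>\<^sub>L 'h) topology"
  let ?N = "\<lambda>y. {H \<in> topspace ?X. cinner (blinfun_apply H x) y \<in> ball (cinner (G x) y) r}"
  have top: "topspace ?X = UNIV"
    by (simp add: weak_operator_topology_def topspace_pullback_topology)
  have "openin ?X (?N y)" for y
    by (rule openin_continuous_map_preimage[OF continuous_map_WOT]) simp
  then have "openin ?X (?N y \<inter> ?N z)"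
    by (intro openin_Int)
  moreover have "G \<in> ?X closure_of {T n F |n. True}"
    using assms closure_of_subtopology_subset[of ?X compact_ops] by fastforce
  moreover have "G \<in> ?N y \<inter> ?N z"
    using \<open>r > 0\<close> by (simp add: top)
  ultimately have "\<exists>H. H \<in> {T n F |n. True} \<and> H \<in> ?N y \<inter> ?N z"
    unfolding in_closure_of by (elim conjE allE[of _ "?N y \<inter> ?N z"] impE conjI)
  then obtain n where "T n F \<in> ?N y \<inter> ?N z"
    by blast
  then have "cinner (T n F x) y \<in> ball (cinner (G x) y) r" "cinner (T n F x) z \<in> ball (cinner (G x) z) r"
    by blast+
  then show ?thesis
    by (auto simp: dist_norm norm_minus_commute)
qed

end

text \<open>The vector is a series of multiples of the \<open>w n\<close> with norms \<open>(1/3)\<^sup>n\<close>. Choosing the sign of the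
  \<open>n\<close>-th term makes its pairing with \<open>w n\<close> large, and the tail, of norm at most half of that term,
  cannot cancel it. For growth \<open>2\<^sup>n\<close> this would just fail.\<close>

lemma ex_vector_bounded_away:
  fixes w :: "nat \<Rightarrow> 'h::complex_hilbert_space"
  assumes "c > 0" and w: "\<And>n. norm (w n) \<ge> c * 4 ^ n"
  shows "\<exists>y. \<forall>n. cmod (cinner (w n) y) \<ge> c / 2"
proof -
  have w_pos: "norm (w n) > 0" for n
    using w[of n] \<open>c > 0\<close> by (smt (verit) mult_pos_pos zero_less_power)
  \<comment> \<open>The conjunct \<open>True\<close> is the trivial invariant that the choice
    principle expects for the single terms.\<close>
  have "\<exists>s. \<forall>n. True \<and> (norm (s (Suc n) - s n) = (1/3) ^ n \<and>
      cmod (cinner (w n) (s (Suc n))) \<ge> (1/3) ^ n * norm (w n))"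
  proof (rule dependent_nat_choice)
    fix x :: 'h and n
    define t where "t = ((1/3) ^ n / norm (w n)) *\<^sub>R w n"
    have t: "norm t = (1/3) ^ n"
      using w_pos[of n] by (simp add: t_def)
    have "cinner (w n) t = complex_of_real ((1/3) ^ n * norm (w n))"
      using w_pos[of n] unfolding t_def cinner.scaleR_right cinner_self
      by (simp add: scaleR_conv_of_real power2_eq_square)
    then have wt: "cmod (cinner (w n) t) = (1/3) ^ n * norm (w n)"
      by (simp only: norm_of_real) simp
    \<comment> \<open>The pairings with \<open>x + t\<close> and \<open>x - t\<close> differ by
      twice that with \<open>t\<close>, so one of them is at least as large as the latter.\<close>
    have "2 * cmod (cinner (w n) t) = cmod (cinner (w n) (x + t) - cinner (w n) (x - t))"
      by (simp add: cinner_add_right cinner_diff_right flip: mult_2 norm_mult)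
    also have "\<dots> \<le> cmod (cinner (w n) (x + t)) + cmod (cinner (w n) (x - t))"
      by (rule norm_triangle_ineq4)
    finally have "cmod (cinner (w n) (x + t)) \<ge> (1/3) ^ n * norm (w n) \<or>
        cmod (cinner (w n) (x - t)) \<ge> (1/3) ^ n * norm (w n)"
      using wt by linarith
    moreover have "norm (x + t - x) = (1/3) ^ n" "norm (x - t - x) = (1/3) ^ n"
      using t by simp_all
    ultimately show "\<exists>y. True \<and> (norm (y - x) = (1/3) ^ n \<and> cmod (cinner (w n) y) \<ge> (1/3) ^ n * norm (w n))"
      by blast
  qed simp
  then obtain s where s: "\<And>n. norm (s (Suc n) - s n) = (1/3) ^ n"
    "\<And>n. cmod (cinner (w n) (s (Suc n))) \<ge> (1/3) ^ n * norm (w n)"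
    by auto
  have tail: "norm (s (n + k) - s n) \<le> (3/2) * (1/3) ^ n" for n k
  proof -
    \<comment> \<open>Keeping the subtracted geometric remainder makes the induction on
      \<open>k\<close> telescope.\<close>
    have "norm (s (n + k) - s n) \<le> (3/2) * (1/3) ^ n - (3/2) * (1/3) ^ (n + k)"
    proof (induction k)
      case (Suc k)
      have "norm (s (n + Suc k) - s n) \<le> norm (s (Suc (n + k)) - s (n + k)) + norm (s (n + k) - s n)"
        using norm_triangle_ineq[of "s (Suc (n + k)) - s (n + k)" "s (n + k) - s n"] by simp
      then show ?case
        using Suc s(1)[of "n + k"] by simp
    qed simp
    then show ?thesis
      by (rule order_trans) simp
  qed
  have "Cauchy s"
  proof (rule CauchyI')
    fix r :: real
    assume "r > 0"
    then obtain M where M: "(1/3) ^ M < r / 2"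
      using real_arch_pow_inv[of "r / 2" "1/3"] by auto
    have "norm (s m - s n) < r" if "m \<ge> M" "n > m" for m n
    proof -
      have "norm (s m - s n) \<le> (3/2) * (1/3) ^ m"
        using tail[of m "n - m"] that by (simp add: norm_minus_commute)
      also have "\<dots> \<le> (3/2) * (1/3) ^ M"
        using that by (intro mult_left_mono power_decreasing) auto
      finally show ?thesis
        using M \<open>r > 0\<close> by simp
    qed
    then show "\<exists>M. \<forall>m\<ge>M. \<forall>n>m. dist (s m) (s n) < r"
      unfolding dist_norm by blast
  qed
  then obtain y where y: "s \<longlonglongrightarrow> y"
    using Cauchy_convergent convergent_def by blast
  have "cmod (cinner (w n) y) \<ge> c / 2" for n
  proof -
    \<comment> \<open>The bound equals \<open>(1/2) * (1/3) ^ n\<close>, so the tail costs at most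
      half of the pairing secured at step \<open>n\<close>.\<close>
    have "norm (y - s (Suc n)) \<le> (3/2) * (1/3) ^ Suc n"
    proof (rule tendsto_upperbound)
      show "(\<lambda>k. norm (s (k + Suc n) - s (Suc n))) \<longlonglongrightarrow> norm (y - s (Suc n))"
        by (intro tendsto_intros LIMSEQ_ignore_initial_segment y)
      show "\<forall>\<^sub>F k in sequentially. norm (s (k + Suc n) - s (Suc n)) \<le> (3/2) * (1/3) ^ Suc n"
        using tail[of "Suc n"] by (intro always_eventually allI) (simp only: add.commute)
    qed simp
    then have "norm (w n) * norm (y - s (Suc n)) \<le> norm (w n) * ((1/2) * (1/3) ^ n)"
      by (intro mult_left_mono) auto
    then have "cmod (cinner (w n) (y - s (Suc n))) \<le> norm (w n) * ((1/2) * (1/3) ^ n)"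
      using norm_cinner_le[of "w n" "y - s (Suc n)"] by linarith
    moreover have "cmod (cinner (w n) (s (Suc n))) - cmod (cinner (w n) (y - s (Suc n)))
        \<le> cmod (cinner (w n) y)"
      using norm_diff_ineq[of "cinner (w n) (s (Suc n))" "cinner (w n) (y - s (Suc n))"]
      by (simp add: cinner_diff_right)
    ultimately have "(1/2) * (1/3) ^ n * norm (w n) \<le> cmod (cinner (w n) y)"
      using s(2)[of n] by (simp add: mult.commute)
    moreover have "c / 2 \<le> (1/2) * (1/3) ^ n * (c * 4 ^ n)"
    proof -
      have "(1 :: real) \<le> (4/3) ^ n"
        by (rule one_le_power) simp
      then show ?thesis
        using \<open>c > 0\<close> by (simp add: power_divide field_simps)
    qed
    moreover have "(1/2) * (1/3) ^ n * (c * 4 ^ n) \<le> (1/2) * (1/3) ^ n * norm (w n)"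
      by (intro mult_left_mono w) simp
    ultimately show ?thesis
      by linarith
  qed
  then show ?thesis
    by blast
qed

context doubled_shift
begin

text \<open>Splitting the orbit by parity raises the growth of each half to \<open>4 ^ n\<close>, as
  \<open>ex_vector_bounded_away\<close> requires.\<close>

lemma not_WOT_hypercyclic: "\<not> WOT_hypercyclic (left_mult U)"
proof
  assume "WOT_hypercyclic (left_mult U)"
  then obtain F where F: "subtopology weak_operator_topology compact_ops closure_of {T n F |n. True} = compact_ops"
    unfolding WOT_hypercyclic_def by blast
  show False
  proof (cases "F = 0")
    case True
    \<comment> \<open>The orbit of 0 is constant and misses a rank-one operator with pairing
      1.\<close>
    have "T n F = 0" for n
      by (rule blinfun_eqI) (use norm_T_apply[of n F] True in simp)
    then show ?thesis
      using WOT_hypercyclic_approx[OF F rank1_compact[of "e 0" "e 0"], of 1 "e 0" "e 0"]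
      by (simp add: cinner_0_left cinner_basis rank1_basis_apply del: rank1.rep_eq)
  next
    case False
    then obtain x where x: "F x \<noteq> 0"
      by (metis blinfun_eqI zero_blinfun.rep_eq)
    let ?c = "norm (F x)"
    have "norm (T (2 * n) F x) \<ge> ?c * 4 ^ n" "norm (T (Suc (2 * n)) F x) \<ge> ?c * 4 ^ n" for n
      using power_mult[of "2 :: real" 2 n] unfolding norm_T_apply by (simp_all add: mult_ac)
    then obtain y z where
      y: "\<And>n. cmod (cinner (T (2 * n) F x) y) \<ge> ?c / 2" and
      z: "\<And>n. cmod (cinner (T (Suc (2 * n)) F x) z) \<ge> ?c / 2"
      using ex_vector_bounded_away[of ?c "\<lambda>n. T (2 * n) F x"]
        ex_vector_bounded_away[of ?c "\<lambda>n. T (Suc (2 * n)) F x"] x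
      by (metis zero_less_norm_iff)
    obtain n where n: "cmod (cinner (T n F x) y) < ?c / 2" "cmod (cinner (T n F x) z) < ?c / 2"
      using WOT_hypercyclic_approx[OF F compact_ops_zero, of "?c / 2" x y z] x
      by (auto simp: cinner_0_left)
    show ?thesis
    proof (cases "even n")
      case True
      then show ?thesis
        using y n(1) by (metis evenE not_le)
    next
      case False
      then show ?thesis
        using z n(2) by (metis oddE Suc_eq_plus1 not_le)
    qed
  qed
qed

subsection \<open>Transitivity\<close>

text \<open>The two perturbations below tend to zero. For \<open>m = 4 n + 2\<close> the ranges involved in the products
  are far enough apart that in \<open>left_factor A n o\<^sub>L T m (right_factor B C n)\<close> only the product of the
  two perturbations survives. It is \<open>P n o\<^sub>L C\<close>, whatever \<open>A\<close> and \<open>B\<close> are.\<close>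

definition left_factor :: "('h \<Rightarrow>\<^sub>L 'h) \<Rightarrow> nat \<Rightarrow> ('h \<Rightarrow>\<^sub>L 'h)" where
  "left_factor A n = (A o\<^sub>L P n) + (1/2) ^ n *\<^sub>R trunc_shift n (2 * int n + 1) 0"

definition right_factor :: "('h \<Rightarrow>\<^sub>L 'h) \<Rightarrow> ('h \<Rightarrow>\<^sub>L 'h) \<Rightarrow> nat \<Rightarrow> ('h \<Rightarrow>\<^sub>L 'h)" where
  "right_factor B C n =
     (P n o\<^sub>L B) + (2 ^ n / 2 ^ (4 * n + 2)) *\<^sub>R (trunc_shift n 0 (- 2 * int n - 1) o\<^sub>L C)"

text \<open>The scalars \<open>(1/2) ^ n\<close>, \<open>2 ^ (4 * n + 2)\<close> and
  \<open>2 ^ n / 2 ^ (4 * n + 2)\<close> multiply to 1.\<close>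

lemma left_factor_T_right_factor:
  "left_factor A n o\<^sub>L T (4 * n + 2) (right_factor B C n) = P n o\<^sub>L C"
proof (rule blinfun_eqI)
  fix x
  let ?k = "2 * int n + 1" and ?l = "4 * int n + 2"
  have "T (4 * n + 2) (right_factor B C n) x
      = 2 ^ (4 * n + 2) *\<^sub>R trunc_shift n 0 ?l (B x) + 2 ^ n *\<^sub>R trunc_shift n 0 ?k (C x)"
  proof -
    \<comment> \<open>The power of the shift moves the window of the perturbation from
      \<open>- 2 * n - 1\<close> to \<open>?k\<close>, and the window around 0 to
      \<open>?l\<close>.\<close>
    have "- 2 * int n - 1 + int (4 * n + 2) = ?k" "0 + int (4 * n + 2) = ?l"
      by simp_all
    then show ?thesis
      by (subst left_mult_funpow)
        (simp only: right_factor_def blinfun_apply_blinfun_compose blinfun.add_left blinfun.add_right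
          blinfun.scaleR_left blinfun.scaleR_right T_trunc_shift, simp)
  qed
  \<comment> \<open>In the three cross terms the centres are \<open>4 * n + 2\<close>,
    \<open>2 * n + 1\<close> and \<open>2 * n + 1\<close> apart.\<close>
  moreover have "P n (trunc_shift n 0 ?l y) = 0" "P n (trunc_shift n 0 ?k y) = 0"
    "trunc_shift n ?k 0 (trunc_shift n 0 ?l y) = 0" for y
    by (rule trunc_shift_trunc_shift_far; simp)+
  moreover have "trunc_shift n ?k 0 (trunc_shift n 0 ?k y) = P n y" for y
    by (rule trunc_shift_trunc_shift)
  ultimately show "(left_factor A n o\<^sub>L T (4 * n + 2) (right_factor B C n)) x = (P n o\<^sub>L C) x"
    by (simp add: left_factor_def blinfun.add_left blinfun.add_right blinfun.scaleR_left
        blinfun.scaleR_right blinfun.zero_right power_divide)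
qed

lemma left_factor_compact: "A \<in> compact_ops \<Longrightarrow> left_factor A n \<in> compact_ops"
  unfolding left_factor_def
  by (intro compact_ops_add compact_ops_comp_right compact_ops_scaleR trunc_shift_compact
      clinear_op_compact)

lemma right_factor_compact:
  "B \<in> compact_ops \<Longrightarrow> C \<in> compact_ops \<Longrightarrow> right_factor B C n \<in> compact_ops"
  unfolding right_factor_def
  by (intro compact_ops_add compact_ops_comp_left compact_ops_scaleR trunc_shift_compact
      clinear_op_compact)

lemma scaled_trunc_shift_tendsto_0: "(\<lambda>n. (1/2) ^ n *\<^sub>R trunc_shift n (a n) (b n)) \<longlonglongrightarrow> 0"
proof (rule Lim_null_comparison)
  show "\<forall>\<^sub>F n in sequentially. norm ((1/2) ^ n *\<^sub>R trunc_shift n (a n) (b n)) \<le> (1/2) ^ n"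
    using mult_left_mono[OF norm_trunc_shift_le, of "(1/2) ^ n" for n] by simp
  show "(\<lambda>n. (1/2 :: real) ^ n) \<longlonglongrightarrow> 0"
    by (rule LIMSEQ_power_zero) simp
qed

lemma left_factor_tendsto:
  assumes "A \<in> compact_ops"
  shows "left_factor A \<longlonglongrightarrow> A"
  unfolding left_factor_def
  using tendsto_add[OF comp_P_tendsto[OF assms] scaled_trunc_shift_tendsto_0] by simp

lemma right_factor_tendsto:
  assumes "B \<in> compact_ops"
  shows "right_factor B C \<longlonglongrightarrow> B"
proof -
  have "(\<lambda>n. (2 ^ n / 2 ^ (4 * n + 2)) *\<^sub>R (trunc_shift n 0 (- 2 * int n - 1) o\<^sub>L C)) \<longlonglongrightarrow> 0"
  proof (rule Lim_null_comparison)
    have "norm ((2 ^ n / 2 ^ (4 * n + 2)) *\<^sub>R (trunc_shift n 0 (- 2 * int n - 1) o\<^sub>L C))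
        \<le> (1/2) ^ n * norm C" for n
    proof -
      have "(2 :: real) ^ n * 2 ^ n \<le> 2 ^ (4 * n + 2)"
        using power_increasing[of "n + n" "4 * n + 2" "2 :: real"] by (simp only: power_add)
      then have "(2 :: real) ^ n / 2 ^ (4 * n + 2) \<le> (1/2) ^ n"
        by (simp add: power_divide field_simps)
      moreover have "norm (trunc_shift n 0 (- 2 * int n - 1) o\<^sub>L C) \<le> 1 * norm C"
        by (rule order_trans[OF norm_blinfun_compose mult_right_mono[OF norm_trunc_shift_le]]) simp
      ultimately show ?thesis
        by (simp only: norm_scaleR) (rule mult_mono, simp_all)
    qed
    then show "\<forall>\<^sub>F n in sequentially.
        norm ((2 ^ n / 2 ^ (4 * n + 2)) *\<^sub>R (trunc_shift n 0 (- 2 * int n - 1) o\<^sub>L C))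
        \<le> (1/2) ^ n * norm C"
      by simp
    show "(\<lambda>n. (1/2) ^ n * norm C) \<longlonglongrightarrow> 0"
      by (intro tendsto_mult_left_zero LIMSEQ_power_zero) simp
  qed
  from tendsto_add[OF P_comp_tendsto[OF assms] this] show ?thesis
    by (simp add: right_factor_def[abs_def])
qed

lemma eventually_in_openin:
  assumes "openin (top_of_set X) V" "l \<in> V" "f \<longlonglongrightarrow> l" "\<forall>\<^sub>F n in sequentially. f n \<in> X"
  shows "\<forall>\<^sub>F n in sequentially. f n \<in> V"
proof -
  obtain O' where O': "open O'" "V = X \<inter> O'"
    using assms(1) by (auto simp: openin_open)
  then have "\<forall>\<^sub>F n in sequentially. f n \<in> O'"
    using assms(2,3) topological_tendstoD by fastforce
  then show ?thesis
    using assms(4) unfolding O'(2) by eventually_elim simp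
qed

text \<open>The two factors converge to a chosen pair in \<open>W\<close>, while their product
  \<open>P n o\<^sub>L C\<close> converges to a point of \<open>V\<close>.\<close>

lemma generalized_numerically_transitive: "generalized_numerically_transitive (left_mult U)"
  unfolding generalized_numerically_transitive_def
proof (intro allI impI, elim conjE)
  fix W :: "(('h \<Rightarrow>\<^sub>L 'h) \<times> ('h \<Rightarrow>\<^sub>L 'h)) set" and V :: "('h \<Rightarrow>\<^sub>L 'h) set"
  assume W: "openin (top_of_set (compact_ops \<times> compact_ops)) W" "W \<noteq> {}"
    and V: "openin (top_of_set compact_ops) V" "V \<noteq> {}"
  obtain A B where AB: "(A, B) \<in> W"
    using W(2) by auto
  obtain C where C: "C \<in> V"
    using V(2) by auto
  have mem: "A \<in> compact_ops" "B \<in> compact_ops" "C \<in> compact_ops"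
    using openin_imp_subset[OF W(1)] openin_imp_subset[OF V(1)] AB C by auto
  have "\<forall>\<^sub>F n in sequentially. (left_factor A n, right_factor B C n) \<in> W"
    by (rule eventually_in_openin[OF W(1) AB])
      (auto intro!: tendsto_Pair left_factor_tendsto right_factor_tendsto left_factor_compact
        right_factor_compact mem always_eventually)
  moreover have "\<forall>\<^sub>F n in sequentially. P n o\<^sub>L C \<in> V"
    by (rule eventually_in_openin[OF V(1) C P_comp_tendsto[OF mem(3)]])
      (intro always_eventually allI compact_ops_comp_left clinear_op_compact trunc_shift_compact mem)
  ultimately have "\<forall>\<^sub>F n in sequentially.
      (left_factor A n, right_factor B C n) \<in> W \<and> P n o\<^sub>L C \<in> V"
    by (rule eventually_conj)
  then obtain n where n: "(left_factor A n, right_factor B C n) \<in> W" "P n o\<^sub>L C \<in> V"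
    by (auto simp: eventually_sequentially)
  show "\<exists>n\<ge>1. \<exists>(A, B)\<in>W. A o\<^sub>L T n B \<in> V"
    using n left_factor_T_right_factor[of A n B C]
    by (intro exI[of _ "4 * n + 2"] conjI bexI[of _ "(left_factor A n, right_factor B C n)"]) auto
qed

text \<open>The same construction, with the left factor realised as an adjoint and both operators
  normalised. Their norms tend to 1, so normalising alters neither limit.\<close>

lemma topologically_Cstar_transitive: "topologically_Cstar_transitive (left_mult U)"
  unfolding topologically_Cstar_transitive_def
proof (intro allI impI, elim conjE)
  fix W :: "(('h \<Rightarrow>\<^sub>L 'h) \<times> ('h \<Rightarrow>\<^sub>L 'h)) set" and V :: "('h \<Rightarrow>\<^sub>L 'h) set"
  assume W: "openin (top_of_set (compact_ops_sphere \<times> compact_ops_sphere)) W" "W \<noteq> {}"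
    and V: "openin (top_of_set compact_ops) V" "V \<noteq> {}"
  obtain A B where AB: "(A, B) \<in> W"
    using W(2) by auto
  obtain C where C: "C \<in> V"
    using V(2) by auto
  have mem: "A \<in> compact_ops" "B \<in> compact_ops" "C \<in> compact_ops" and norm1: "norm A = 1" "norm B = 1"
    using openin_imp_subset[OF W(1)] openin_imp_subset[OF V(1)] AB C
    by (auto simp: compact_ops_sphere_def)
  define Y where "Y = right_factor A C"
  \<comment> \<open>Chosen so that its adjoint is \<open>left_factor (adjoint_op B) n\<close>:
    taking adjoints swaps the order of composition and the two shift parameters.\<close>
  define Z where "Z n = (P n o\<^sub>L B) + (1/2) ^ n *\<^sub>R trunc_shift n 0 (2 * int n + 1)" for n
  have Y: "Y n \<in> compact_ops" and Z: "Z n \<in> compact_ops" for n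
    unfolding Y_def Z_def
    by (intro right_factor_compact compact_ops_add compact_ops_comp_left compact_ops_scaleR
        trunc_shift_compact clinear_op_compact mem)+
  have Y_lim: "Y \<longlonglongrightarrow> A"
    unfolding Y_def by (rule right_factor_tendsto[OF mem(1)])
  have Z_lim: "Z \<longlonglongrightarrow> B"
    using tendsto_add[OF P_comp_tendsto[OF mem(2)] scaled_trunc_shift_tendsto_0]
    by (simp add: Z_def[abs_def])
  have norm_lim: "(\<lambda>n. inverse (norm (Y n))) \<longlonglongrightarrow> 1" "(\<lambda>n. inverse (norm (Z n))) \<longlonglongrightarrow> 1"
    using tendsto_inverse[OF tendsto_norm[OF Y_lim]] tendsto_inverse[OF tendsto_norm[OF Z_lim]] norm1
    by auto
  \<comment> \<open>Only nonzero operators can be scaled onto the unit sphere.\<close>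
  have "\<forall>\<^sub>F n in sequentially. norm (Y n) > 0" "\<forall>\<^sub>F n in sequentially. norm (Z n) > 0"
    using order_tendstoD(1)[OF tendsto_norm[OF Y_lim], of 0]
      order_tendstoD(1)[OF tendsto_norm[OF Z_lim], of 0] norm1 by auto
  then have sphere: "\<forall>\<^sub>F n in sequentially. (Y n /\<^sub>R norm (Y n), Z n /\<^sub>R norm (Z n))
      \<in> compact_ops_sphere \<times> compact_ops_sphere"
    by eventually_elim (auto simp: compact_ops_sphere_def intro!: compact_ops_scaleR Y Z)
  have "\<forall>\<^sub>F n in sequentially. (Y n /\<^sub>R norm (Y n), Z n /\<^sub>R norm (Z n)) \<in> W"
    by (rule eventually_in_openin[OF W(1) AB _ sphere])
      (use tendsto_Pair[OF tendsto_scaleR[OF norm_lim(1) Y_lim] tendsto_scaleR[OF norm_lim(2) Z_lim]]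
        in simp)
  moreover have "\<forall>\<^sub>F n in sequentially.
      (inverse (norm (Z n)) * inverse (norm (Y n))) *\<^sub>R (P n o\<^sub>L C) \<in> V"
    by (rule eventually_in_openin[OF V(1) C])
      (use tendsto_scaleR[OF tendsto_mult[OF norm_lim(2,1)] P_comp_tendsto[OF mem(3)]] in
        \<open>auto intro!: always_eventually compact_ops_scaleR compact_ops_comp_left clinear_op_compact
          trunc_shift_compact mem\<close>)
  ultimately have "\<forall>\<^sub>F n in sequentially. (Y n /\<^sub>R norm (Y n), Z n /\<^sub>R norm (Z n)) \<in> W \<and>
      (inverse (norm (Z n)) * inverse (norm (Y n))) *\<^sub>R (P n o\<^sub>L C) \<in> V"
    by (rule eventually_conj)
  then obtain n where n: "(Y n /\<^sub>R norm (Y n), Z n /\<^sub>R norm (Z n)) \<in> W"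
    "(inverse (norm (Z n)) * inverse (norm (Y n))) *\<^sub>R (P n o\<^sub>L C) \<in> V"
    by (auto simp: eventually_sequentially)
  have "adjoint_op (Z n /\<^sub>R norm (Z n)) = left_factor (adjoint_op B) n /\<^sub>R norm (Z n)"
    by (rule adjoint_op_eqI)
      (simp add: Z_def left_factor_def blinfun.add_left blinfun.scaleR_left cinner.scaleR_left
        cinner.scaleR_right cinner_add_left cinner_add_right cinner_trunc_shift cinner_adjoint_op
        clinear_op_compact mem)
  moreover have "T (4 * n + 2) (Y n /\<^sub>R norm (Y n)) = T (4 * n + 2) (Y n) /\<^sub>R norm (Y n)"
    using left_mult_funpow[of "4 * n + 2" U "Y n"] left_mult_funpow[of "4 * n + 2" U "Y n /\<^sub>R norm (Y n)"]
    by (simp add: bounded_bilinear.scaleR_right[OF bounded_bilinear_blinfun_compose])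
  ultimately have "adjoint_op (Z n /\<^sub>R norm (Z n)) o\<^sub>L T (4 * n + 2) (Y n /\<^sub>R norm (Y n))
      = (inverse (norm (Z n)) * inverse (norm (Y n))) *\<^sub>R (P n o\<^sub>L C)"
    using left_factor_T_right_factor[of "adjoint_op B" n A C]
    by (simp add: bounded_bilinear.scaleR_right[OF bounded_bilinear_blinfun_compose] Y_def
        bounded_bilinear.scaleR_left[OF bounded_bilinear_blinfun_compose] mult.commute)
  then show "\<exists>n\<ge>1. \<exists>(A, B)\<in>W. adjoint_op B o\<^sub>L T n A \<in> V"
    using n
    by (intro exI[of _ "4 * n + 2"] conjI bexI[of _ "(Y n /\<^sub>R norm (Y n), Z n /\<^sub>R norm (Z n))"]) auto
qed

end

theorem proposition4p6:
  fixes e :: "int \<Rightarrow> 'h::complex_hilbert_space"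
    and S U :: "'h \<Rightarrow>\<^sub>L 'h"
  assumes "orthonormal_basis e"
    and "clinear_op S" and "\<And>j. S (e j) = e (j + 1)"
    and "U = 2 *\<^sub>R S"
  shows "bounded_operator_on_compact_ops (left_mult U) \<and>
    \<not> supercyclic (left_mult U) \<and>
    topologically_Cstar_transitive (left_mult U) \<and>
    generalized_numerically_transitive (left_mult U) \<and>
    \<not> WOT_hypercyclic (left_mult U)"
proof -
  interpret doubled_shift e S U
    by (intro doubled_shift.intro int_orthonormal_basis.intro doubled_shift_axioms.intro assms)
  show ?thesis
    using bounded_operator_on_compact_ops_left_mult[OF U_clinear] not_supercyclic
      topologically_Cstar_transitive generalized_numerically_transitive not_WOT_hypercyclic
    by blast
qed

end
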